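(* Let $\mathbb{F}\in\{\mathbb{R},\mathbb{C}\}$, let $n$ be a positive integer and let $A=[a_{ij}]\in\mathbb{F}^{n\times n}$. Then $$\mu(A)\le\rho(|A|),$$ where $|A|=[|a_{ij}|]$. Equality holds if $A$ is sign equivalent to $|A|$.
   Context: $\rho$ denotes the spectral radius (maximum modulus of all complex eigenvalues). $\|\cdot\|_2$ is the Euclidean norm on $\mathbb{F}^n$. $\mathcal{D}_n(\mathbb{F})$ is the group of diagonal matrices in $\mathbb{F}^{n\times n}$ all of whose diagonal entries have absolute value $1$. The quantity $\mu(A)$ is defined by $$\mu(A)=\limsup_{k\to\infty}\Big(\max\big\{\|AD_1AD_2\cdots AD_k\mathbf{x}\|_2 : D_1,\dots,D_k\in\mathcal{D}_n(\mathbb{F}),\ \mathbf{x}\in\mathbb{F}^n,\ \|\mathbf{x}\|_2=1\big\}\Big)^{1/k},$$ where in the product there are $k$ factors $A$, each followed by one of $D_1,\dots,D_k$. A matrix $A\in\mathbb{F}^{n\times n}$ is sign equivalent to $B\in\mathbb{F}^{n\times n}$ if $A=D_1BD_2$ for some $D_1,D_2\in\mathcal{D}_n(\mathbb{F})$. *)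

theory Defs
  imports
    "HOL-Analysis.L2_Norm"
    "HOL-Analysis.Function_Topology"
    "HOL-Analysis.Topology_Euclidean_Space"
    "HOL-Library.Liminf_Limsup"
    "HOL-Library.Extended_Real"
    "Jordan_Normal_Form.Spectral_Radius"
begin

definition vec_norm2 :: "'a::real_normed_field vec \<Rightarrow> real" where
  "vec_norm2 v = L2_set (\<lambda>i. norm (v $ i)) {..<dim_vec v}"

definition unimodular_diag :: "nat \<Rightarrow> 'a::real_normed_field mat set" where
  "unimodular_diag n =
     {D \<in> carrier_mat n n. diagonal_mat D \<and> (\<forall>i<n. norm (D $$ (i, i)) = 1)}"

definition sign_equivalent :: "nat \<Rightarrow> 'a::real_normed_field mat \<Rightarrow> 'a mat \<Rightarrow> bool" where
  "sign_equivalent n A B \<longleftrightarrow>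
     (\<exists>D1 \<in> unimodular_diag n. \<exists>D2 \<in> unimodular_diag n. A = D1 * B * D2)"

definition abs_mat :: "'a::real_normed_field mat \<Rightarrow> real mat" where
  "abs_mat A = map_mat norm A"

text \<open>For \<open>Ds = [D1, \<dots>, Dk]\<close> this is the product \<open>A D1 A D2 \<dots> A Dk\<close>.\<close>

definition interleaved_prod :: "nat \<Rightarrow> 'a::real_normed_field mat \<Rightarrow> 'a mat list \<Rightarrow> 'a mat" where
  "interleaved_prod n A Ds = foldr (\<lambda>D M. A * D * M) Ds (1\<^sub>m n)"

definition growth_values :: "nat \<Rightarrow> 'a::real_normed_field mat \<Rightarrow> nat \<Rightarrow> real set" where
  "growth_values n A k =
     {vec_norm2 (interleaved_prod n A Ds *\<^sub>v x) | Ds x.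
        length Ds = k \<and> set Ds \<subseteq> unimodular_diag n \<and> x \<in> carrier_vec n \<and> vec_norm2 x = 1}"

text \<open>The constant \<^const>\<open>Max\<close> is meaningful only on finite sets, so the maximum of the infinite
  set \<^const>\<open>growth_values\<close> is written as a supremum. Lemma \<open>max_growth_attained\<close> below shows that
  for \<open>n > 0\<close> over the reals and the complex numbers this is indeed a maximum.\<close>

definition max_growth :: "nat \<Rightarrow> 'a::real_normed_field mat \<Rightarrow> nat \<Rightarrow> real" where
  "max_growth n A k = Sup (growth_values n A k)"

text \<open>The upper limit is taken in the extended reals, where it always exists. The term for
  \<open>k = 0\<close> is irrelevant.\<close>

definition mu :: "nat \<Rightarrow> 'a::real_normed_field mat \<Rightarrow> ereal" where
  "mu n A = limsup (\<lambda>k. ereal (root k (max_growth n A k)))"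

lemma compact_Pi_UNIV:
  fixes K :: "nat \<Rightarrow> 'a::topological_space set"
  assumes "\<And>i. compact (K i)"
  shows "compact {f. \<forall>i. f i \<in> K i}"
proof -
  have "{f. \<forall>i. f i \<in> K i} = PiE UNIV K" by (auto simp: PiE_def)
  moreover have "compactin (product_topology (\<lambda>i. euclidean) UNIV) (PiE UNIV K)"
    using assms by (simp add: compactin_PiE)
  ultimately show ?thesis by (simp add: euclidean_product_topology)
qed

lemma interleaved_prod_carrier:
  assumes "A \<in> carrier_mat n n" "set Ds \<subseteq> unimodular_diag n"
  shows "interleaved_prod n A Ds \<in> carrier_mat n n"
  using assms(2)
proof (induction Ds)
  case (Cons D Ds)
  then have "D \<in> carrier_mat n n" by (auto simp: unimodular_diag_def)
  with Cons assms(1) show ?case by (auto simp: interleaved_prod_def intro!: mult_carrier_mat)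
qed (simp add: interleaved_prod_def)

lemma max_growth_attained:
  fixes A :: "'a::{real_normed_field,heine_borel} mat"
  assumes A: "A \<in> carrier_mat n n" and n: "n > 0"
  shows "max_growth n A k \<in> growth_values n A k"
    and "r \<in> growth_values n A k \<Longrightarrow> r \<le> max_growth n A k"
proof -
  define V where "V k = {interleaved_prod n A Ds *\<^sub>v x | Ds x. length Ds = k \<and>
     set Ds \<subseteq> unimodular_diag n \<and> x \<in> carrier_vec n \<and> vec_norm2 x = 1}" for k
  define crd :: "'a vec \<Rightarrow> nat \<Rightarrow> 'a" where "crd v = (\<lambda>i. if i < n then v $ i else 0)" for v
  define N :: "(nat \<Rightarrow> 'a) \<Rightarrow> real" where "N f = L2_set (\<lambda>i. norm (f i)) {..<n}" for f
  define step where "step = (\<lambda>(d :: nat \<Rightarrow> 'a, y :: nat \<Rightarrow> 'a) i.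
     if i < n then \<Sum>j<n. A $$ (i,j) * (d j * y j) else 0)"
  define DD :: "(nat \<Rightarrow> 'a) set" where
    "DD = {d. \<forall>i. d i \<in> (if i < n then sphere 0 1 else {0})}"
  have contN: "continuous_on X N" for X
    unfolding N_def L2_set_def
    by (intro continuous_intros continuous_on_product_coordinates continuous_on_subset[OF _ subset_UNIV])
  have Ncrd: "N (crd v) = vec_norm2 v" if "v \<in> carrier_vec n" for v
    using that unfolding N_def crd_def vec_norm2_def by (auto intro!: L2_set_cong)
  have crd_vec: "crd (vec n f) = f" if "\<And>i. i \<ge> n \<Longrightarrow> f i = 0" for f
    using that by (auto simp: crd_def fun_eq_iff)
  have Vc: "V k \<subseteq> carrier_vec n" for k
    using interleaved_prod_carrier[OF A] by (auto simp: V_def intro!: mult_mat_vec_carrier)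
  have V0: "V 0 = {x \<in> carrier_vec n. vec_norm2 x = 1}"
    by (auto simp: V_def interleaved_prod_def intro: one_mult_mat_vec[symmetric])
  have VS: "V (Suc k) = {A *\<^sub>v (D *\<^sub>v v) | D v. D \<in> unimodular_diag n \<and> v \<in> V k}" (is "_ = ?R") for k
  proof -
    have eq: "interleaved_prod n A (D # Ds) *\<^sub>v x = A *\<^sub>v (D *\<^sub>v (interleaved_prod n A Ds *\<^sub>v x))"
      if "D \<in> unimodular_diag n" "set Ds \<subseteq> unimodular_diag n" "x \<in> carrier_vec n" for D Ds x
    proof -
      have D: "D \<in> carrier_mat n n" using that by (auto simp: unimodular_diag_def)
      have P: "interleaved_prod n A Ds \<in> carrier_mat n n"
        using that interleaved_prod_carrier[OF A] by auto
      have "interleaved_prod n A (D # Ds) = A * D * interleaved_prod n A Ds"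
        by (simp add: interleaved_prod_def)
      then show ?thesis
        using A D P that(3) by (simp add: assoc_mult_mat_vec[of _ n n _ n])
    qed
    show ?thesis
    proof (intro equalityI subsetI)
      fix w assume "w \<in> V (Suc k)"
      then obtain Ds x where w: "w = interleaved_prod n A Ds *\<^sub>v x" "length Ds = Suc k"
        "set Ds \<subseteq> unimodular_diag n" "x \<in> carrier_vec n" "vec_norm2 x = 1"
        unfolding V_def by blast
      then obtain D Es where Ds: "Ds = D # Es" "length Es = k" by (cases Ds) auto
      from w Ds have "w = A *\<^sub>v (D *\<^sub>v (interleaved_prod n A Es *\<^sub>v x))" using eq by auto
      moreover from w Ds have "interleaved_prod n A Es *\<^sub>v x \<in> V k" unfolding V_def by auto
      ultimately show "w \<in> ?R" using w Ds by auto
    next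
      fix w assume "w \<in> ?R"
      then obtain D Ds x where w: "w = A *\<^sub>v (D *\<^sub>v (interleaved_prod n A Ds *\<^sub>v x))"
        "D \<in> unimodular_diag n" "length Ds = k" "set Ds \<subseteq> unimodular_diag n"
        "x \<in> carrier_vec n" "vec_norm2 x = 1"
        unfolding V_def by blast
      then show "w \<in> V (Suc k)" unfolding V_def using eq
        by (auto intro!: exI[of _ "D # Ds"] exI[of _ x])
    qed
  qed
  have diag: "(D *\<^sub>v v) $ i = D $$ (i,i) * v $ i"
    if "D \<in> unimodular_diag n" "v \<in> carrier_vec n" "i < n" for D :: "'a mat" and v i
  proof -
    have "(D *\<^sub>v v) $ i = (\<Sum>j<n. D $$ (i,j) * v $ j)"
      using that by (auto simp: unimodular_diag_def scalar_prod_def atLeast0LessThan)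
    also have "\<dots> = (\<Sum>j<n. if j = i then D $$ (i,i) * v $ i else 0)"
      using that by (intro sum.cong) (auto simp: unimodular_diag_def diagonal_mat_def)
    finally show ?thesis using that by simp
  qed
  have stepeq: "crd (A *\<^sub>v (D *\<^sub>v v)) = step (\<lambda>i. if i < n then D $$ (i,i) else 0, crd v)"
    if D: "D \<in> unimodular_diag n" and v: "v \<in> carrier_vec n" for D v
  proof
    fix i
    have entry: "(A *\<^sub>v w) $ i = (\<Sum>j<n. A $$ (i,j) * w $ j)"
      if "w \<in> carrier_vec n" "i < n" for w
      using that A by (auto simp: scalar_prod_def atLeast0LessThan)
    have "D *\<^sub>v v \<in> carrier_vec n" using D v by (auto simp: unimodular_diag_def)
    then show "crd (A *\<^sub>v (D *\<^sub>v v)) i = step (\<lambda>i. if i < n then D $$ (i,i) else 0, crd v) i"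
      by (auto simp: crd_def step_def entry diag[OF D v] simp del: index_mult_mat_vec
          intro!: sum.cong)
  qed
  have "compact (crd ` V k)" for k
  proof (induction k)
    case 0
    have "crd ` V 0 = {f. \<forall>i. f i \<in> (if i < n then cball 0 1 else {0})} \<inter> {f. N f = 1}"
      (is "_ = ?K \<inter> ?C")
    proof (intro equalityI subsetI)
      fix f assume "f \<in> crd ` V 0"
      then obtain v where v: "v \<in> carrier_vec n" "vec_norm2 v = 1" and f: "f = crd v"
        unfolding V0 by blast
      have N1: "N f = 1" using v f Ncrd by simp
      have "norm (f i) \<le> N f" if "i < n" for i
        unfolding N_def using that by (intro member_le_L2_set) auto
      then show "f \<in> ?K \<inter> ?C" using N1 f by (auto simp: crd_def)
    next
      fix f assume f: "f \<in> ?K \<inter> ?C"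
      then have z: "f i = 0" if "i \<ge> n" for i
        using that by (auto dest!: spec[of _ i] split: if_splits)
      then have "f = crd (vec n f)" using crd_vec by simp
      moreover have "vec n f \<in> V 0" unfolding V0 using f Ncrd[of "vec n f"] crd_vec z by auto
      ultimately show "f \<in> crd ` V 0" by blast
    qed
    moreover have "compact ?K" by (intro compact_Pi_UNIV) auto
    moreover have "closed ?C"
      by (intro closed_Collect_eq contN continuous_on_const)
    ultimately show ?case by (simp only: compact_Int_closed)
  next
    case (Suc k)
    have "crd ` V (Suc k) = step ` (DD \<times> crd ` V k)"
    proof (intro equalityI subsetI)
      fix f assume "f \<in> crd ` V (Suc k)"
      then obtain D v where *: "D \<in> unimodular_diag n" "v \<in> V k" "f = crd (A *\<^sub>v (D *\<^sub>v v))"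
        unfolding VS by blast
      have "(\<lambda>i. if i < n then D $$ (i,i) else 0) \<in> DD"
        using * by (auto simp: DD_def unimodular_diag_def)
      moreover have "f = step (\<lambda>i. if i < n then D $$ (i,i) else 0, crd v)"
        using * Vc stepeq[of D v] by auto
      ultimately show "f \<in> step ` (DD \<times> crd ` V k)" using *(2) by blast
    next
      fix f assume "f \<in> step ` (DD \<times> crd ` V k)"
      then obtain d v where *: "d \<in> DD" "v \<in> V k" "f = step (d, crd v)" by blast
      define D where "D = mat n n (\<lambda>(i,j). if i = j then d i else 0)"
      have d1: "norm (d i) = 1" if "i < n" for i
        using *(1) that by (auto simp: DD_def dest!: spec[of _ i])
      have d0: "d i = 0" if "\<not> i < n" for i
        using *(1) that by (auto simp: DD_def dest!: spec[of _ i])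
      have D: "D \<in> unimodular_diag n"
        using d1 by (auto simp: D_def unimodular_diag_def diagonal_mat_def)
      have "(\<lambda>i. if i < n then D $$ (i,i) else 0) = d"
        using d0 by (auto simp: fun_eq_iff D_def)
      then have "f = crd (A *\<^sub>v (D *\<^sub>v v))" using stepeq[OF D] * Vc by (metis subsetD)
      then show "f \<in> crd ` V (Suc k)" unfolding VS using D * by blast
    qed
    moreover have "compact DD" unfolding DD_def by (intro compact_Pi_UNIV) auto
    moreover have "continuous_on X step" for X
    proof (rule continuous_on_coordinatewise_then_product)
      fix i
      have c1: "continuous_on X (\<lambda>p. fst p j)" and c2: "continuous_on X (\<lambda>p. snd p j)"
        for j :: nat and X :: "((nat \<Rightarrow> 'a) \<times> (nat \<Rightarrow> 'a)) set"
        by (rule continuous_on_product_then_coordinatewise,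
            intro continuous_on_fst continuous_on_snd continuous_on_id)+
      show "continuous_on X (\<lambda>p. step p i)"
        by (cases "i < n")
          (simp_all add: step_def case_prod_beta c1 c2 continuous_on_sum continuous_on_mult
            continuous_on_const)
    qed
    ultimately show ?case using Suc by (auto intro!: compact_continuous_image compact_Times)
  qed
  moreover have gv: "growth_values n A k = N ` crd ` V k"
  proof -
    have "growth_values n A k = vec_norm2 ` V k" by (auto simp: growth_values_def V_def)
    also have "\<dots> = (\<lambda>v. N (crd v)) ` V k" using Ncrd Vc[of k] by (intro image_cong) auto
    finally show ?thesis by (simp add: image_image)
  qed
  ultimately have cpt: "compact (growth_values n A k)"
    unfolding gv by (intro compact_continuous_image contN)
  have "vec_norm2 (unit_vec n 0 :: 'a vec) = 1"
  proof -
    have "(\<Sum>i<n. (norm ((unit_vec n 0 :: 'a vec) $ i))\<^sup>2) = (\<Sum>i<n. if i = 0 then 1 else 0)"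
      by (intro sum.cong) (auto simp: unit_vec_def)
    then show ?thesis using n by (simp add: vec_norm2_def L2_set_def)
  qed
  moreover have "1\<^sub>m n \<in> unimodular_diag n"
    by (auto simp: unimodular_diag_def diagonal_mat_def)
  ultimately have "vec_norm2 (interleaved_prod n A (replicate k (1\<^sub>m n)) *\<^sub>v unit_vec n 0)
      \<in> growth_values n A k"
    unfolding growth_values_def
    by (auto intro!: exI[of _ "replicate k (1\<^sub>m n)"] exI[of _ "unit_vec n 0"])
  then have ne: "growth_values n A k \<noteq> {}" by blast
  have bdd: "bdd_above (growth_values n A k)"
    using cpt by (simp add: compact_imp_bounded bounded_imp_bdd_above)
  show "max_growth n A k \<in> growth_values n A k"
    unfolding max_growth_def using cpt ne bdd by (intro closed_contains_Sup compact_imp_closed)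
  show "r \<in> growth_values n A k \<Longrightarrow> r \<le> max_growth n A k"
    unfolding max_growth_def using bdd by (rule cSup_upper[rotated])
qed

end

theory Submission
  imports Defs
begin

text \<open>The triangle inequality bounds the entries of \<open>A D1 \<dots> A Dk\<close> by those of \<open>|A|\<^sup>k\<close>, which are
  \<open>O(s\<^sup>k)\<close> for every \<open>s > \<rho>(|A|)\<close>. If \<open>A = D |A| D'\<close>, then taking every \<open>Di\<close> to be \<open>(D D')\<^sup>-\<^sup>1\<close> turns the
  product into \<open>D |A|\<^sup>k D\<^sup>-\<^sup>1\<close>, whose entries have the moduli of those of \<open>|A|\<^sup>k\<close>. An eigenvector for
  an eigenvalue of maximal modulus shows that some entry of \<open>|A|\<^sup>k\<close> is at least a constant times
  \<open>\<rho>(|A|)\<^sup>k\<close>. Testing with unit vectors instead of the eigenvector itself treats the real case,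
  where the eigenvector need not be real, like the complex one.\<close>

section \<open>Entries of matrix products, powers and diagonal scalings\<close>

lemma index_mult_mat_sum:
  assumes "A \<in> carrier_mat n m" "B \<in> carrier_mat m p" "i < n" "j < p"
  shows "(A * B) $$ (i,j) = (\<Sum>l<m. A $$ (i,l) * B $$ (l,j))"
  using assms by (auto simp: scalar_prod_def atLeast0LessThan)

lemma index_mult_mat_vec_sum:
  assumes "A \<in> carrier_mat n m" "v \<in> carrier_vec m" "i < n"
  shows "(A *\<^sub>v v) $ i = (\<Sum>l<m. A $$ (i,l) * v $ l)"
  using assms by (auto simp: scalar_prod_def atLeast0LessThan)

text \<open>\<open>pow_mat\<close> recurses on the right, whereas \<open>interleaved_prod\<close>
  peels off its factors on the left. This form lets one induction unfold both.\<close>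

lemma pow_mat_Suc_left:
  assumes "A \<in> carrier_mat n n"
  shows "A ^\<^sub>m Suc k = A * A ^\<^sub>m k"
proof (induction k)
  case 0
  then show ?case using assms by simp
next
  case (Suc k)
  have "A ^\<^sub>m Suc (Suc k) = A * A ^\<^sub>m k * A"
    using Suc by simp
  also have "\<dots> = A * A ^\<^sub>m Suc k"
    using assms by (simp add: assoc_mult_mat[of _ n n _ n _ n])
  finally show ?case .
qed

lemma smult_pow_mat:
  fixes A :: "'a::comm_semiring_1 mat"
  assumes "A \<in> carrier_mat n n"
  shows "(c \<cdot>\<^sub>m A) ^\<^sub>m k = c ^ k \<cdot>\<^sub>m A ^\<^sub>m k"
proof (induction k)
  case 0
  then show ?case using assms by (intro eq_matI) auto
next
  case (Suc k)
  then have "(c \<cdot>\<^sub>m A) ^\<^sub>m Suc k = (c ^ k \<cdot>\<^sub>m A ^\<^sub>m k) * (c \<cdot>\<^sub>m A)"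
    by simp
  also have "\<dots> = c ^ Suc k \<cdot>\<^sub>m A ^\<^sub>m Suc k"
    using assms
    by (intro eq_matI)
       (auto simp: scalar_prod_def sum_distrib_left algebra_simps intro!: sum.cong)
  finally show ?case .
qed

lemma mult_diagonal_mat_index:
  fixes A :: "'a::semiring_1 mat"
  assumes "A \<in> carrier_mat n n" "D \<in> carrier_mat n n" "diagonal_mat D" "i < n" "j < n"
  shows "(A * D) $$ (i,j) = A $$ (i,j) * D $$ (j,j)"
    and "(D * A) $$ (i,j) = D $$ (i,i) * A $$ (i,j)"
proof -
  have "(A * D) $$ (i,j) = (\<Sum>l<n. if l = j then A $$ (i,j) * D $$ (j,j) else 0)"
    unfolding index_mult_mat_sum[OF assms(1,2,4,5)]
    using assms by (intro sum.cong) (auto simp: diagonal_mat_def)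
  then show "(A * D) $$ (i,j) = A $$ (i,j) * D $$ (j,j)"
    using assms by simp
  have "(D * A) $$ (i,j) = (\<Sum>l<n. if l = i then D $$ (i,i) * A $$ (i,j) else 0)"
    unfolding index_mult_mat_sum[OF assms(2,1,4,5)]
    using assms by (intro sum.cong) (auto simp: diagonal_mat_def)
  then show "(D * A) $$ (i,j) = D $$ (i,i) * A $$ (i,j)"
    using assms by simp
qed

section \<open>Entrywise bounds by powers of the absolute value matrix\<close>

lemma abs_mat_carrier: "A \<in> carrier_mat n m \<Longrightarrow> abs_mat A \<in> carrier_mat n m"
  by (simp add: abs_mat_def)

text \<open>A unimodular diagonal factor only rescales the columns of \<open>A\<close> by numbers of
  modulus 1, so it disappears once the triangle inequality has moved the norms inside the
  sum.\<close>

lemma norm_interleaved_prod_le: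
  assumes A: "A \<in> carrier_mat n n" and "set Ds \<subseteq> unimodular_diag n" "i < n" "j < n"
  shows "norm (interleaved_prod n A Ds $$ (i,j)) \<le> (abs_mat A ^\<^sub>m length Ds) $$ (i,j)"
  using assms(2-)
\<comment> \<open>The row is generalised because the step applies the induction hypothesis at every
  row \<open>l\<close> of the remaining product; the column \<open>j\<close> stays fixed.\<close>
proof (induction Ds arbitrary: i)
  case Nil
  then show ?case using A by (simp add: interleaved_prod_def abs_mat_def)
next
  case (Cons D Ds)
  let ?M = "interleaved_prod n A Ds"
  have D: "D \<in> carrier_mat n n" "diagonal_mat D" "\<And>i. i < n \<Longrightarrow> norm (D $$ (i,i)) = 1"
    using Cons.prems by (auto simp: unimodular_diag_def)
  have M: "?M \<in> carrier_mat n n"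
    using interleaved_prod_carrier[OF A] Cons.prems by auto
  have "interleaved_prod n A (D # Ds) $$ (i,j) = (A * D * ?M) $$ (i,j)"
    by (simp add: interleaved_prod_def)
  also have "\<dots> = (\<Sum>l<n. A $$ (i,l) * D $$ (l,l) * ?M $$ (l,j))"
    using A D M Cons.prems
    by (subst index_mult_mat_sum[of _ n n _ n])
       (auto simp del: index_mult_mat intro!: sum.cong simp: mult_diagonal_mat_index(1)[of _ n])
  also have "norm \<dots> \<le> (\<Sum>l<n. norm (A $$ (i,l)) * norm (?M $$ (l,j)))"
    using D by (intro sum_norm_le) (simp add: norm_mult)
  also have "\<dots> \<le> (\<Sum>l<n. norm (A $$ (i,l)) * (abs_mat A ^\<^sub>m length Ds) $$ (l,j))"
    using Cons by (intro sum_mono mult_left_mono) auto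
  also have "\<dots> = (abs_mat A * abs_mat A ^\<^sub>m length Ds) $$ (i,j)"
    using A Cons.prems abs_mat_carrier[OF A]
    by (subst index_mult_mat_sum[of _ n n _ n]) (auto simp: abs_mat_def)
  finally show ?case
    by (simp add: pow_mat_Suc_left[OF abs_mat_carrier[OF A]] del: pow_mat.simps)
qed

text \<open>Dividing by \<open>s\<close> brings the spectral radius below 1, where the Jordan normal
  form gives a bound on all powers at once. Scaling back contributes the factor
  \<open>s ^ k\<close>.\<close>

lemma pow_mat_entries_le_spectral_radius:
  fixes C :: "complex mat"
  assumes C: "C \<in> carrier_mat n n" and n: "n > 0" and s: "spectral_radius C < s" "s > 0"
  shows "\<exists>c. \<forall>k. norm_bound (C ^\<^sub>m k) (c * s ^ k)"
proof -
  define E where "E = complex_of_real (1 / s) \<cdot>\<^sub>m C"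
  have E: "E \<in> carrier_mat n n" using C by (simp add: E_def)
  have CE: "C = complex_of_real s \<cdot>\<^sub>m E"
    using s by (intro eq_matI) (auto simp: E_def)
  have "spectral_radius E < 1"
  proof -
    \<comment> \<open>An eigenvalue \<open>ev\<close> of \<open>E\<close> of maximal modulus lifts
      to the eigenvalue \<open>s * ev\<close> of \<open>C\<close>, with the same
      eigenvector.\<close>
    obtain ev where ev: "ev \<in> spectrum E" "spectral_radius E = norm ev"
      using spectral_radius_mem_max(1)[OF E n] by auto
    then obtain v where v: "eigenvector E v ev"
      by (auto simp: spectrum_def eigenvalue_def)
    then have "v \<in> carrier_vec n" "v \<noteq> 0\<^sub>v n" "E *\<^sub>v v = ev \<cdot>\<^sub>v v"
      using E by (auto simp: eigenvector_def)
    moreover have "C *\<^sub>v v = complex_of_real s \<cdot>\<^sub>v (E *\<^sub>v v)"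
      using E \<open>v \<in> carrier_vec n\<close> unfolding CE by (intro eq_vecI) auto
    ultimately have "eigenvector C v (complex_of_real s * ev)"
      using C by (auto simp: eigenvector_def smult_smult_assoc)
    then have "norm (complex_of_real s * ev) \<le> spectral_radius C"
      by (intro spectral_radius_mem_max(2)[OF C n] imageI)
         (auto simp: spectrum_def eigenvalue_def)
    then have "s * norm ev \<le> spectral_radius C" using s by (simp add: norm_mult)
    also have "\<dots> < s * 1" using s by simp
    finally show ?thesis using s ev by (simp del: mult_1_right)
  qed
  then obtain c where c: "norm_bound (E ^\<^sub>m k) c" for k
    using spectral_radius_jnf_norm_bound_less_1_upper_triangular[OF E] by auto
  have "norm_bound (C ^\<^sub>m k) (c * s ^ k)" for k
    using c[of k] E s unfolding CE smult_pow_mat[OF E]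
    by (auto simp: norm_bound_def norm_mult norm_power mult.commute mult_right_mono)
  then show ?thesis by blast
qed

section \<open>The Euclidean norm compared with entries\<close>

lemma norm_index_le_vec_norm2: "i < dim_vec v \<Longrightarrow> norm (v $ i) \<le> vec_norm2 v"
  unfolding vec_norm2_def by (intro member_le_L2_set) auto

lemma vec_norm2_unit_vec:
  assumes "j < n"
  shows "vec_norm2 (unit_vec n j :: 'a::real_normed_field vec) = 1"
proof -
  have "(\<Sum>i<n. (norm ((unit_vec n j :: 'a vec) $ i))\<^sup>2) = (\<Sum>i<n. if i = j then 1 else 0)"
    using assms by (intro sum.cong) (auto simp: unit_vec_def)
  then show ?thesis using assms by (simp add: vec_norm2_def L2_set_def)
qed

text \<open>One factor \<open>n\<close> comes from summing along a row, the other from bounding the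
  Euclidean norm by the sum of the moduli. Such a crude constant is harmless, since its
  \<open>k\<close>-th root tends to 1.\<close>

lemma vec_norm2_mult_mat_vec_le:
  assumes M: "M \<in> carrier_mat n n" and b: "norm_bound M b" and x: "x \<in> carrier_vec n"
  shows "vec_norm2 (M *\<^sub>v x) \<le> (real n)\<^sup>2 * b * vec_norm2 x"
proof -
  have "norm ((M *\<^sub>v x) $ i) \<le> real n * b * vec_norm2 x" if i: "i < n" for i
  proof -
    have "norm ((M *\<^sub>v x) $ i) \<le> (\<Sum>l<n. b * vec_norm2 x)"
      unfolding index_mult_mat_vec_sum[OF M x i]
    proof (intro sum_norm_le)
      fix l assume "l \<in> {..<n}"
      then have l: "l < n" by simp
      \<comment> \<open>This also yields \<open>b \<ge> 0\<close>, which the product estimate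
        requires and which is not among the hypotheses.\<close>
      have "norm (M $$ (i,l)) \<le> b" using b M i l by (auto simp: norm_bound_def)
      then show "norm (M $$ (i,l) * x $ l) \<le> b * vec_norm2 x"
        unfolding norm_mult using norm_index_le_vec_norm2[of l x] x l
        by (intro mult_mono) (auto intro: order_trans[OF norm_ge_zero])
    qed
    then show ?thesis by simp
  qed
  then have "(\<Sum>i<n. norm ((M *\<^sub>v x) $ i)) \<le> (\<Sum>i<n. real n * b * vec_norm2 x)"
    by (intro sum_mono) simp
  moreover have "vec_norm2 (M *\<^sub>v x) \<le> (\<Sum>i<n. norm ((M *\<^sub>v x) $ i))"
    using M L2_set_le_sum[of "{..<n}" "\<lambda>i. norm ((M *\<^sub>v x) $ i)"] by (simp add: vec_norm2_def)
  ultimately show ?thesis by (simp add: power2_eq_square)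
qed

section \<open>Roots of geometric bounds and their upper limits\<close>

text \<open>The reason why positive constant factors do not affect \<open>mu\<close>: the
  \<open>k\<close>-th root of \<open>c\<close> tends to 1.\<close>

lemma tendsto_root_mult_power:
  fixes c s :: real
  assumes "c > 0" "s \<ge> 0"
  shows "(\<lambda>k. root k (c * s ^ k)) \<longlonglongrightarrow> s"
proof -
  have "(\<lambda>k. root k c * s) \<longlonglongrightarrow> 1 * s"
    using assms by (intro tendsto_intros LIMSEQ_root_const)
  moreover have "\<forall>\<^sub>F k in sequentially. root k c * s = root k (c * s ^ k)"
    using eventually_gt_at_top[of 0]
    by eventually_elim (use assms in \<open>simp add: real_root_mult real_root_power_cancel\<close>)
  ultimately show ?thesis by (simp add: filterlim_cong)
qed

lemma limsup_root_le:
  fixes f :: "nat \<Rightarrow> real"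
  assumes "\<And>k. f k \<le> c * s ^ k" "c > 0" "s \<ge> 0"
  shows "limsup (\<lambda>k. ereal (root k (f k))) \<le> ereal s"
proof -
  have "limsup (\<lambda>k. ereal (root k (f k))) \<le> limsup (\<lambda>k. ereal (root k (c * s ^ k)))"
    using assms(1) by (intro Limsup_mono eventually_mono[OF eventually_gt_at_top[of 0]]) simp
  also have "\<dots> = ereal s"
    using tendsto_root_mult_power[OF assms(2,3)] by (intro lim_imp_Limsup) auto
  finally show ?thesis .
qed

lemma limsup_root_ge:
  fixes f :: "nat \<Rightarrow> real"
  assumes "\<And>k. c * s ^ k \<le> f k" "c > 0" "s \<ge> 0"
  shows "ereal s \<le> limsup (\<lambda>k. ereal (root k (f k)))"
proof -
  have "ereal s = limsup (\<lambda>k. ereal (root k (c * s ^ k)))"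
    using tendsto_root_mult_power[OF assms(2,3)] by (intro lim_imp_Limsup[symmetric]) auto
  also have "\<dots> \<le> limsup (\<lambda>k. ereal (root k (f k)))"
    using assms(1) by (intro Limsup_mono eventually_mono[OF eventually_gt_at_top[of 0]]) simp
  finally show ?thesis .
qed

section \<open>The upper bound for \<open>mu\<close>\<close>

lemma spectral_radius_nonneg:
  assumes "C \<in> carrier_mat n n" "n > 0"
  shows "spectral_radius C \<ge> 0"
  using spectral_radius_mem_max(1)[OF assms] by auto

text \<open>The bound is proved for every \<open>s\<close> above the spectral radius and then
  \<open>s\<close> is lowered. At the spectral radius itself a nontrivial Jordan block can add
  polynomial growth, so a bound by a constant times its \<open>k\<close>-th power may fail.\<close>

lemma mu_le_spectral_radius:
  fixes A :: "'a::{real_normed_field,heine_borel} mat"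
  assumes A: "A \<in> carrier_mat n n" and n: "n > 0"
  shows "mu n A \<le> ereal (spectral_radius (map_mat complex_of_real (abs_mat A)))"
proof -
  define R where "R = map_mat complex_of_real (abs_mat A)"
  have R: "R \<in> carrier_mat n n" using A by (simp add: R_def abs_mat_def)
  have Rpow: "R ^\<^sub>m k = map_mat complex_of_real (abs_mat A ^\<^sub>m k)" for k
    unfolding R_def by (rule of_real_hom.mat_hom_pow[OF abs_mat_carrier[OF A], symmetric])
  have "mu n A \<le> ereal s" if s: "spectral_radius R < s" for s
  proof -
    have s0: "s > 0" using s spectral_radius_nonneg[OF R n] by linarith
    obtain c where c: "\<And>k. norm_bound (R ^\<^sub>m k) (c * s ^ k)"
      using pow_mat_entries_le_spectral_radius[OF R n s s0] by blast
    \<comment> \<open>Using \<open>max c 1\<close> instead of \<open>c\<close> makes the positivity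
      demanded by \<open>limsup_root_le\<close> immediate.\<close>
    have "max_growth n A k \<le> ((real n)\<^sup>2 * max c 1) * s ^ k" for k
    proof -
      obtain Ds x where Ds: "length Ds = k" "set Ds \<subseteq> unimodular_diag n" "x \<in> carrier_vec n"
        "vec_norm2 x = 1" "max_growth n A k = vec_norm2 (interleaved_prod n A Ds *\<^sub>v x)"
        using max_growth_attained(1)[OF A n, of k] unfolding growth_values_def by auto
      have P: "interleaved_prod n A Ds \<in> carrier_mat n n"
        by (rule interleaved_prod_carrier[OF A Ds(2)])
      have "norm_bound (interleaved_prod n A Ds) (max c 1 * s ^ k)"
      proof (rule norm_boundI)
        fix i j
        assume "i < dim_row (interleaved_prod n A Ds)" "j < dim_col (interleaved_prod n A Ds)"
        then have ij: "i < n" "j < n" using P by auto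
        have "norm (interleaved_prod n A Ds $$ (i,j)) \<le> (abs_mat A ^\<^sub>m k) $$ (i,j)"
          using norm_interleaved_prod_le[OF A Ds(2) ij] Ds(1) by simp
        also have "\<dots> \<le> norm ((R ^\<^sub>m k) $$ (i,j))"
          using ij A by (simp add: Rpow abs_mat_def)
        also have "\<dots> \<le> c * s ^ k"
          using c[of k] ij R by (simp add: norm_bound_def)
        also have "\<dots> \<le> max c 1 * s ^ k"
          using s0 by (intro mult_right_mono) auto
        finally show "norm (interleaved_prod n A Ds $$ (i,j)) \<le> max c 1 * s ^ k" .
      qed
      from vec_norm2_mult_mat_vec_le[OF P this Ds(3)] show ?thesis
        using Ds by (simp add: mult_ac)
    qed
    then show ?thesis
      unfolding mu_def using s0 n
      by (intro limsup_root_le[where c = "(real n)\<^sup>2 * max c 1"]) (auto simp: less_max_iff_disj)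
  qed
  \<comment> \<open>The admissible values of \<open>s\<close> are taken in the form
    \<open>spectral_radius R + e\<close>.\<close>
  then have "mu n A \<le> ereal (spectral_radius R) + ereal e" if "e > 0" for e
    using that by simp
  then show ?thesis
    unfolding R_def[symmetric] by (rule ereal_le_epsilon2)
qed

section \<open>The lower bound under sign equivalence\<close>

text \<open>The witness turns \<open>A * D\<close> into the diagonal conjugate
  \<open>D1 * |A| * D1^-1\<close>, whose powers telescope. A single \<open>D\<close> therefore
  serves all \<open>k\<close>.\<close>

lemma interleaved_prod_sign_equivalent:
  fixes A :: "'a::real_normed_field mat"
  assumes A: "A \<in> carrier_mat n n"
    and D1: "D1 \<in> unimodular_diag n" and D2: "D2 \<in> unimodular_diag n"
    and eq: "A = D1 * map_mat of_real (abs_mat A) * D2"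
  shows "\<exists>D \<in> unimodular_diag n. \<forall>k. \<forall>i<n. \<forall>j<n.
    norm (interleaved_prod n A (replicate k D) $$ (i,j)) = norm ((abs_mat A ^\<^sub>m k) $$ (i,j))"
proof -
  let ?B = "map_mat of_real (abs_mat A) :: 'a mat"
  define d where "d i = D1 $$ (i,i)" for i
  define e where "e i = D2 $$ (i,i)" for i
  have d: "norm (d i) = 1" and e: "norm (e i) = 1" if "i < n" for i
    using D1 D2 that by (auto simp: d_def e_def unimodular_diag_def)
  have d0: "d i \<noteq> 0" and e0: "e i \<noteq> 0" if "i < n" for i
    using d[OF that] e[OF that] by auto
  define D where "D = mat n n (\<lambda>(i,j). if i = j then inverse (d i * e i) else 0)"
  have D: "D \<in> carrier_mat n n" "diagonal_mat D"
    by (auto simp: D_def diagonal_mat_def)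
  have Du: "D \<in> unimodular_diag n"
    using d e by (auto simp: unimodular_diag_def D_def diagonal_mat_def norm_mult norm_inverse)
  have B: "?B \<in> carrier_mat n n" using A by (simp add: abs_mat_def)
  have Aij: "A $$ (i,j) = d i * of_real (abs_mat A $$ (i,j)) * e j" if "i < n" "j < n" for i j
  proof -
    have "A $$ (i,j) = (D1 * ?B * D2) $$ (i,j)" using eq by simp
    also have "\<dots> = (D1 * ?B) $$ (i,j) * e j"
      using D1 D2 B that unfolding e_def
      by (intro mult_diagonal_mat_index) (auto simp: unimodular_diag_def)
    also have "(D1 * ?B) $$ (i,j) = d i * ?B $$ (i,j)"
      using D1 B that unfolding d_def
      by (intro mult_diagonal_mat_index) (auto simp: unimodular_diag_def)
    finally show ?thesis using that A by (simp add: abs_mat_def)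
  qed
  \<comment> \<open>This is \<open>(A * D)^k = D1 * |A|^k * D1^-1\<close> read entrywise, so that no
    inverse matrix has to be handled.\<close>
  have entry: "interleaved_prod n A (replicate k D) $$ (i,j) =
      d i * of_real ((abs_mat A ^\<^sub>m k) $$ (i,j)) * inverse (d j)" if "i < n" "j < n" for i j k
    using that
  proof (induction k arbitrary: i)
    case 0
    then show ?case using A d0 by (auto simp: interleaved_prod_def abs_mat_def)
  next
    case (Suc k)
    let ?M = "interleaved_prod n A (replicate k D)"
    have M: "?M \<in> carrier_mat n n"
      using Du by (intro interleaved_prod_carrier[OF A]) auto
    have "interleaved_prod n A (replicate (Suc k) D) $$ (i,j) = (A * D * ?M) $$ (i,j)"
      by (simp add: interleaved_prod_def)
    also have "\<dots> = (\<Sum>l<n. A $$ (i,l) * D $$ (l,l) * ?M $$ (l,j))"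
      using A D M Suc.prems
      by (subst index_mult_mat_sum[of _ n n _ n])
         (auto simp del: index_mult_mat intro!: sum.cong simp: mult_diagonal_mat_index(1)[of _ n])
    \<comment> \<open>For each \<open>l\<close> the factor \<open>e l\<close> from \<open>A\<close>,
      the diagonal entry \<open>inverse (d l * e l)\<close> of \<open>D\<close> and the factor
      \<open>d l\<close> from the induction hypothesis cancel.\<close>
    also have "\<dots> = (\<Sum>l<n. d i *
        of_real (abs_mat A $$ (i,l) * (abs_mat A ^\<^sub>m k) $$ (l,j)) * inverse (d j))"
      using Suc d0 e0 by (intro sum.cong) (auto simp: Aij D_def field_simps)
    also have "\<dots> = d i * of_real ((abs_mat A * abs_mat A ^\<^sub>m k) $$ (i,j)) * inverse (d j)"
      using Suc.prems abs_mat_carrier[OF A]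
      by (subst index_mult_mat_sum[of _ n n _ n]) (auto simp: sum_distrib_left sum_distrib_right)
    finally show ?case
      by (simp add: pow_mat_Suc_left[OF abs_mat_carrier[OF A]] del: pow_mat.simps)
  qed
  have "norm (interleaved_prod n A (replicate k D) $$ (i,j)) = norm ((abs_mat A ^\<^sub>m k) $$ (i,j))"
    if "i < n" "j < n" for i j k
    using that by (simp add: entry norm_mult norm_inverse d)
  then show ?thesis using Du by blast
qed

text \<open>An eigenvector \<open>v\<close> satisfies \<open>C^k v = ev^k v\<close>. Read at a
  coordinate \<open>i\<close> with \<open>v $ i\<close> nonzero, this prevents all entries in row
  \<open>i\<close> of \<open>C^k\<close> from being small. The row and the constant do not depend on
  \<open>k\<close>; the column may.\<close>

lemma pow_mat_entry_ge_spectral_radius: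
  fixes C :: "complex mat"
  assumes C: "C \<in> carrier_mat n n" and n: "n > 0"
  shows "\<exists>c>0. \<forall>k. \<exists>i<n. \<exists>j<n. c * spectral_radius C ^ k \<le> norm ((C ^\<^sub>m k) $$ (i,j))"
proof -
  obtain ev where ev: "ev \<in> spectrum C" "spectral_radius C = norm ev"
    using spectral_radius_mem_max(1)[OF C n] by auto
  then obtain v where "eigenvector C v ev"
    by (auto simp: spectrum_def eigenvalue_def)
  then have v: "v \<in> carrier_vec n" "v \<noteq> 0\<^sub>v n" and pow: "C ^\<^sub>m k *\<^sub>v v = ev ^ k \<cdot>\<^sub>v v" for k
    using C eigenvector_pow[OF C] by (auto simp: eigenvector_def)
  obtain i where i: "i < n" "v $ i \<noteq> 0"
    using v by (metis carrier_vecD eq_vecI index_zero_vec(1) index_zero_vec(2))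
  \<comment> \<open>With this sum of moduli, row entries all below
    \<open>norm (v $ i) / S * norm ev ^ k\<close> would make coordinate \<open>i\<close> of
    \<open>C^k v\<close> smaller than \<open>norm ev ^ k * norm (v $ i)\<close>.\<close>
  define S where "S = (\<Sum>l<n. norm (v $ l))"
  have "norm (v $ i) \<le> S"
    unfolding S_def using i by (intro member_le_sum) auto
  then have S: "S > 0" using i by (meson less_le_trans zero_less_norm_iff)
  have "\<exists>j<n. norm (v $ i) / S * norm ev ^ k \<le> norm ((C ^\<^sub>m k) $$ (i,j))" for k
  proof (rule ccontr)
    assume "\<not> ?thesis"
    then have lt: "norm ((C ^\<^sub>m k) $$ (i,j)) \<le> norm (v $ i) / S * norm ev ^ k"
      and lt': "norm ((C ^\<^sub>m k) $$ (i,j)) < norm (v $ i) / S * norm ev ^ k" if "j < n" for j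
      using that by (auto simp: not_le intro: less_imp_le)
    have "norm ev ^ k * norm (v $ i) = norm ((C ^\<^sub>m k *\<^sub>v v) $ i)"
      unfolding pow using i v by (simp add: norm_mult norm_power)
    also have "\<dots> \<le> (\<Sum>l<n. norm ((C ^\<^sub>m k) $$ (i,l)) * norm (v $ l))"
      using C v i by (subst index_mult_mat_vec_sum[of _ n n]) (auto intro!: sum_norm_le simp: norm_mult)
    also have "\<dots> < (\<Sum>l<n. (norm (v $ i) / S * norm ev ^ k) * norm (v $ l))"
    \<comment> \<open>Some weights \<open>norm (v $ l)\<close> may vanish, so strictness is claimed
      only at \<open>l = i\<close>, where the weight is positive.\<close>
    proof (rule sum_strict_mono_ex1)
      show "\<exists>l\<in>{..<n}. norm ((C ^\<^sub>m k) $$ (i,l)) * norm (v $ l)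
          < (norm (v $ i) / S * norm ev ^ k) * norm (v $ l)"
        using i lt' by (intro bexI[of _ i] mult_strict_right_mono) auto
    qed (simp, intro ballI mult_right_mono lt, auto)
    also have "\<dots> = norm ev ^ k * norm (v $ i)"
      unfolding sum_distrib_left[symmetric] S_def[symmetric] using S by simp
    finally show False by simp
  qed
  then show ?thesis
    using i S ev by (intro exI[of _ "norm (v $ i) / S"]) auto
qed

text \<open>The complex eigenvector enters only through a modulus bound on an entry of
  \<open>|A|^k\<close>. That modulus is shared by the product over the original field, so one
  argument covers both fields.\<close>

lemma spectral_radius_le_mu:
  fixes A :: "'a::{real_normed_field,heine_borel} mat"
  assumes A: "A \<in> carrier_mat n n" and n: "n > 0"
    and equiv: "sign_equivalent n A (map_mat of_real (abs_mat A))"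
  shows "ereal (spectral_radius (map_mat complex_of_real (abs_mat A))) \<le> mu n A"
proof -
  define R where "R = map_mat complex_of_real (abs_mat A)"
  have R: "R \<in> carrier_mat n n" using A by (simp add: R_def abs_mat_def)
  have Rpow: "R ^\<^sub>m k = map_mat complex_of_real (abs_mat A ^\<^sub>m k)" for k
    unfolding R_def by (rule of_real_hom.mat_hom_pow[OF abs_mat_carrier[OF A], symmetric])
  obtain D where D: "D \<in> unimodular_diag n" and
    norm_eq: "\<And>k i j. i < n \<Longrightarrow> j < n \<Longrightarrow>
      norm (interleaved_prod n A (replicate k D) $$ (i,j)) = norm ((abs_mat A ^\<^sub>m k) $$ (i,j))"
    using equiv interleaved_prod_sign_equivalent[OF A] unfolding sign_equivalent_def by metis
  obtain c where c: "c > 0"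
    "\<And>k. \<exists>i<n. \<exists>j<n. c * spectral_radius R ^ k \<le> norm ((R ^\<^sub>m k) $$ (i,j))"
    using pow_mat_entry_ge_spectral_radius[OF R n] by blast
  have "c * spectral_radius R ^ k \<le> max_growth n A k" for k
  proof -
    let ?P = "interleaved_prod n A (replicate k D)"
    have P: "?P \<in> carrier_mat n n"
      using D by (intro interleaved_prod_carrier[OF A]) auto
    obtain i j where ij: "i < n" "j < n"
      and le: "c * spectral_radius R ^ k \<le> norm ((R ^\<^sub>m k) $$ (i,j))"
      using c(2) by blast
    note le
    also have "norm ((R ^\<^sub>m k) $$ (i,j)) = norm (?P $$ (i,j))"
      using ij A by (simp add: Rpow norm_eq abs_mat_def)
    \<comment> \<open>The unit vector selects column \<open>j\<close>, which may vary with
      \<open>k\<close>, and is an admissible test vector over either field.\<close>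
    also have "?P $$ (i,j) = (?P *\<^sub>v unit_vec n j) $ i"
      using P ij by simp
    also have "norm \<dots> \<le> vec_norm2 (?P *\<^sub>v unit_vec n j)"
      using P ij by (intro norm_index_le_vec_norm2) auto
    also have "\<dots> \<le> max_growth n A k"
    proof (rule max_growth_attained(2)[OF A n])
      show "vec_norm2 (?P *\<^sub>v unit_vec n j) \<in> growth_values n A k"
        unfolding growth_values_def using D ij
        by (auto intro!: exI[of _ "replicate k D"] exI[of _ "unit_vec n j"] vec_norm2_unit_vec)
    qed
    finally show ?thesis .
  qed
  then show ?thesis
    unfolding mu_def R_def[symmetric]
    using c(1) spectral_radius_nonneg[OF R n] by (intro limsup_root_ge[where c = c]) auto
qed

theorem lemma4p1:
  fixes n :: nat
  assumes "n > 0"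
  shows "(\<forall>A :: real mat. A \<in> carrier_mat n n \<longrightarrow>
            mu n A \<le> ereal (spectral_radius (map_mat complex_of_real (abs_mat A))) \<and>
            (sign_equivalent n A (abs_mat A) \<longrightarrow>
              mu n A = ereal (spectral_radius (map_mat complex_of_real (abs_mat A))))) \<and>
         (\<forall>A :: complex mat. A \<in> carrier_mat n n \<longrightarrow>
            mu n A \<le> ereal (spectral_radius (map_mat complex_of_real (abs_mat A))) \<and>
            (sign_equivalent n A (map_mat complex_of_real (abs_mat A)) \<longrightarrow>
              mu n A = ereal (spectral_radius (map_mat complex_of_real (abs_mat A)))))"
proof -
  \<comment> \<open>Over the reals the embedding \<open>of_real\<close> is the identity, which
    matches the generic hypothesis on sign equivalence with the real one.\<close>
  have "map_mat of_real B = B" for B :: "real mat"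
    by (intro eq_matI) auto
  then show ?thesis
    using assms mu_le_spectral_radius[where 'a = real] mu_le_spectral_radius[where 'a = complex]
      spectral_radius_le_mu[where 'a = real] spectral_radius_le_mu[where 'a = complex]
    by (metis order_antisym)
qed

end
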